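(* Let $\gamma=\cos(\alpha/2)$, and for $z=e^{i\theta}$, $0\le\theta\le2\pi$, put $z^{k/2}=e^{ik\theta/2}$ and $x=\gamma^{-1}\cos(\theta/2)=(2\gamma)^{-1}(z^{1/2}+z^{-1/2})$. Let $L_n$ be the monic Legendre polynomials and let $\Phi_n$, $\chi_n$ be as in the context for the weight $f$. 1) Let $0\le\alpha<\pi$, $f(\theta)=\sin(\theta/2)$ if $\alpha\le\theta\le2\pi-\alpha$, and $f(\theta)=0$ otherwise. Then for $n=0,1,\dots$ $$\Phi_n(z)=\frac{(2\gamma)^{n+1}z^{n/2}}{z-1}\left(z^{1/2}L_{n+1}(x)-\frac{L_{n+1}(\gamma^{-1})}{L_n(\gamma^{-1})}L_n(x)\right),\qquad \chi_n^{-2}=(2\gamma)^{2n}\,\frac{\gamma^2}{\pi}\,\frac{L_{n+1}(\gamma^{-1})}{L_n(\gamma^{-1})}\,h_n,\qquad h_n=\frac{2^{2n+1}}{(2n+1)\binom{2n}{n}^2}.$$ 2) Let $0<\alpha<\pi$, $f(\theta)=1/\sin(\theta/2)$ if $\alpha\le\theta\le2\pi-\alpha$, and $f(\theta)=0$ otherwise. Put $$t_k=\frac1{2\pi}\int_\alpha^{2\pi-\alpha}z^{k/2}L_k(x)f(\theta)\,d\theta,\qquad k=0,1,\dots$$ Then $\chi_0^{-2}=t_0$ and for $n=1,2,\dots$ $$\Phi_n(z)=(2\gamma)^nz^{n/2}\left(L_n(x)-z^{-1/2}\frac{t_n}{t_{n-1}}L_{n-1}(x)\right),\qquad \chi_n^{-2}=(2\gamma)^{2n}\,\frac{t_n}{\pi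 t_{n-1}}\,h'_{n-1},\qquad h'_n=\frac{2^{2n+1}}{(2n+1)\binom{2n}{n}^2}.$$
   Context: The monic Legendre polynomials are $$L_n(x)=\frac{2^n}{\binom{2n}{n}}\sum_{k=0}^n\binom nk\binom{n+k}k\left(\frac{x-1}2\right)^k=x^n+\dots$$ For a weight function $f$ on $[0,2\pi]$, $\Phi_n(z)=z^n+\dots$, $n=0,1,\dots$, denote the monic polynomials with $$\frac1{2\pi}\int_0^{2\pi}\Phi_n(e^{i\theta})\overline{\Phi_m(e^{i\theta})}f(\theta)\,d\theta=\frac{\delta_{mn}}{\chi_n^2},\qquad m,n=0,1,\dots$$ Formulas with denominator $z-1$ are for $z\neq1$. *)

theory Defs
  imports "HOL-Analysis.Analysis" "HOL-Computational_Algebra.Polynomial"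
begin

definition monic_legendre :: "nat \<Rightarrow> real \<Rightarrow> real" where
  "monic_legendre n x =
     2 ^ n / real ((2 * n) choose n) *
       (\<Sum>k=0..n. real (n choose k) * real ((n + k) choose k) * ((x - 1) / 2) ^ k)"

text \<open>The right-hand side of the orthogonality relation determines the \<open>chi n\<close> only up to sign, and
  no sign is imposed here; \<open>chi n \<noteq> 0\<close> only makes \<open>1 / (chi n)\<^sup>2\<close> meaningful.\<close>

definition monic_opuc :: "(real \<Rightarrow> real) \<Rightarrow> (nat \<Rightarrow> complex poly) \<Rightarrow> (nat \<Rightarrow> real) \<Rightarrow> bool" where
  "monic_opuc f \<Phi> chi \<longleftrightarrow>
     (\<forall>n. degree (\<Phi> n) = n \<and> lead_coeff (\<Phi> n) = 1 \<and> chi n \<noteq> 0) \<and>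
     (\<forall>m n. 1 / (2 * of_real pi) *
        integral {0..2 * pi}
          (\<lambda>\<theta>. poly (\<Phi> n) (cis \<theta>) * cnj (poly (\<Phi> m) (cis \<theta>)) * of_real (f \<theta>)) =
        (if m = n then 1 / (of_real (chi n))\<^sup>2 else 0))"

definition weight_sin :: "real \<Rightarrow> real \<Rightarrow> real" where
  "weight_sin \<alpha> \<theta> = (if \<alpha> \<le> \<theta> \<and> \<theta> \<le> 2 * pi - \<alpha> then sin (\<theta> / 2) else 0)"

definition weight_inv_sin :: "real \<Rightarrow> real \<Rightarrow> real" where
  "weight_inv_sin \<alpha> \<theta> = (if \<alpha> \<le> \<theta> \<and> \<theta> \<le> 2 * pi - \<alpha> then 1 / sin (\<theta> / 2) else 0)"

definition gam :: "real \<Rightarrow> real" where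
  "gam \<alpha> = cos (\<alpha> / 2)"

definition arc_x :: "real \<Rightarrow> real \<Rightarrow> real" where
  "arc_x \<alpha> \<theta> = cos (\<theta> / 2) / gam \<alpha>"

text \<open>The power \<open>z\<^bsup>k/2\<^esup>\<close> of \<open>z = cis \<theta>\<close>. It depends on \<open>\<theta>\<close> and not only on \<open>z\<close>: the two
  endpoints \<open>\<theta> = 0\<close> and \<open>\<theta> = 2 * pi\<close> give \<open>z = 1\<close> but \<open>z\<^bsup>1/2\<^esup> = 1\<close> and \<open>z\<^bsup>1/2\<^esup> = -1\<close>.\<close>

definition zhalf :: "int \<Rightarrow> real \<Rightarrow> complex" where
  "zhalf k \<theta> = exp (\<i> * of_int k * of_real \<theta> / 2)"

text \<open>As in its defining formula, this is a priori complex; it is real by the symmetry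
  \<open>\<theta> \<mapsto> 2 * pi - \<theta>\<close>.\<close>

definition tcoef :: "real \<Rightarrow> nat \<Rightarrow> complex" where
  "tcoef \<alpha> k = 1 / (2 * of_real pi) *
     integral {\<alpha>..2 * pi - \<alpha>}
       (\<lambda>\<theta>. zhalf (int k) \<theta> * of_real (monic_legendre k (arc_x \<alpha> \<theta>)) *
             of_real (weight_inv_sin \<alpha> \<theta>))"

text \<open>The value of \<open>\<integral> (L\<^sub>n(x))\<^sup>2 dx\<close> over \<open>{-1..1}\<close>.\<close>

definition legendre_h :: "nat \<Rightarrow> real" where
  "legendre_h n = 2 ^ (2 * n + 1) / ((2 * real n + 1) * (real ((2 * n) choose n))\<^sup>2)"

end

theory Submission
  imports Defs
begin

text \<open>
  By parity of the Legendre polynomials, \<open>A\<^sub>n(z) = (2\<gamma>)\<^sup>n z\<^bsup>n/2\<^esup> L\<^sub>n(x)\<close> is a monic polynomial of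
  degree \<open>n\<close> in \<open>z\<close>. Everything rests on the moments of \<open>z\<^bsup>k/2\<^esup> L\<^sub>m(x)\<close> over the arc against \<open>d\<theta>\<close> for
  \<open>k + m\<close> odd: the cosine part vanishes under \<open>\<theta> \<mapsto> 2\<pi> - \<theta>\<close>, and since
  \<open>sin (k\<theta>/2) = sin (\<theta>/2) U\<^bsub>k-1\<^esub>(\<gamma>x)\<close> with \<open>dx = - sin (\<theta>/2) d\<theta> / (2\<gamma>)\<close>, the sine part vanishes by
  Legendre orthogonality unless \<open>\<bar>k\<bar> > m\<close>.
  For the weight \<open>sin (\<theta>/2)\<close>, the quotient \<open>(A\<^sub>n\<^sub>+\<^sub>1 - c A\<^sub>n) / (z - 1)\<close> has inner products with
  \<open>z\<^sup>j\<close> of exactly this kind, because \<open>z - 1 = 2i sin (\<theta>/2) z\<^bsup>1/2\<^esup>\<close>.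
  For the weight \<open>1 / sin (\<theta>/2)\<close>, the inner products of \<open>A\<^sub>n\<close> with \<open>z\<^sup>j - z\<^bsup>j+1\<^esup>\<close> are of this kind, so
  those with \<open>1, z, \<dots>, z\<^sup>n\<close> all equal a multiple of \<open>t\<^sub>n\<close>, and the combination of \<open>A\<^sub>n\<close> and \<open>A\<^sub>n\<^sub>-\<^sub>1\<close> is
  chosen to cancel them.
\<close>

subsection \<open>Legendre polynomials\<close>

lemma poly_antiderivative: "\<exists>q. pderiv q = (p :: 'a :: field_char_0 poly)"
proof
  have "pderiv (\<Sum>i\<le>degree p. monom (coeff p i / of_nat (Suc i)) (Suc i)) =
      (\<Sum>i\<le>degree p. monom (coeff p i) i)"
    \<comment> \<open>The sum rule for one derivative is taken as the first-order case of the rule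
      for iterated derivatives.\<close>
    by (simp add: higher_pderiv_sum[of 1, simplified] pderiv_monom del: of_nat_Suc)
  then show "pderiv (\<Sum>i\<le>degree p. monom (coeff p i / of_nat (Suc i)) (Suc i)) = p"
    by (simp add: poly_as_sum_of_monoms)
qed

lemma poly_integrable [intro, simp]:
  fixes p :: "real poly"
  shows "(poly p) integrable_on {a..b}"
  by (intro integrable_continuous_interval continuous_intros)

lemma integral_pderiv:
  fixes p :: "real poly"
  assumes "a \<le> b"
  shows "integral {a..b} (poly (pderiv p)) = poly p b - poly p a"
  by (intro integral_unique fundamental_theorem_of_calculus assms)
    (metis has_real_derivative_iff_has_vector_derivative has_vector_derivative_at_within poly_DERIV)

lemma integral_poly_add:
  fixes p q :: "real poly"
  shows "integral {a..b} (poly (p + q)) = integral {a..b} (poly p) + integral {a..b} (poly q)"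
  by (simp add: poly_add[abs_def] Henstock_Kurzweil_Integration.integral_add)

lemma integral_poly_smult:
  fixes p :: "real poly"
  shows "integral {a..b} (poly (smult c p)) = c * integral {a..b} (poly p)"
  by (simp add: poly_smult[abs_def])

section \<open>Rodrigues' formula and Legendre orthogonality\<close>

definition leg_base :: "real poly" where
  "leg_base = [:-1, 0, 1:]"

lemma poly_leg_base [simp]: "poly leg_base x = x\<^sup>2 - 1"
  by (simp add: leg_base_def power2_eq_square)

lemma integral_by_parts_pderiv:
  fixes p q :: "real poly"
  assumes "poly p (-1) = 0" "poly p 1 = 0"
  shows "integral {-1..1} (poly (pderiv p * q)) = - integral {-1..1} (poly (p * pderiv q))"
proof -
  have "integral {-1..1} (poly (pderiv (p * q))) = 0"
    using assms by (subst integral_pderiv) auto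
  then show ?thesis
    by (simp add: pderiv_mult integral_poly_add algebra_simps)
qed

text \<open>Each differentiation costs at most one order of vanishing at 1 and at -1. This kills the
  boundary terms in repeated integration by parts. Truncated subtraction makes the case
  \<open>i \<ge> n\<close> trivial.\<close>

lemma leg_base_power_dvd_pderiv: "leg_base ^ (n - i) dvd (pderiv ^^ i) (leg_base ^ n)"
proof (induction i)
  case (Suc i)
  then obtain r where r: "(pderiv ^^ i) (leg_base ^ n) = leg_base ^ (n - i) * r"
    by (auto elim: dvdE)
  show ?case
  proof (cases "n - i")
    case (Suc m)
    then have "n - Suc i = m" by simp
    then show ?thesis
      unfolding funpow.simps o_apply r Suc pderiv_mult pderiv_power_Suc
      by (intro dvd_add) (auto intro: dvd_mult dvd_mult2 dvd_smult)
  next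
    case 0
    then have "n - Suc i = 0" by simp
    then show ?thesis by simp
  qed
qed simp

text \<open>Integrate by parts i times: fewer than n derivatives of \<open>leg_base ^ n\<close>
  leave a factor \<open>leg_base\<close>, so no boundary term survives.\<close>

lemma integral_rodrigues:
  fixes q :: "real poly"
  assumes "i \<le> n"
  shows "integral {-1..1} (poly ((pderiv ^^ i) (leg_base ^ n) * q)) =
    (-1) ^ i * integral {-1..1} (poly (leg_base ^ n * (pderiv ^^ i) q))"
  using assms
proof (induction i arbitrary: q)
  case (Suc i)
  obtain r where r: "(pderiv ^^ i) (leg_base ^ n) = leg_base ^ (n - i) * r"
    using leg_base_power_dvd_pderiv by (meson dvdE)
  have "integral {-1..1} (poly (pderiv ((pderiv ^^ i) (leg_base ^ n)) * q)) =
      - integral {-1..1} (poly ((pderiv ^^ i) (leg_base ^ n) * pderiv q))"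
    using Suc.prems by (intro integral_by_parts_pderiv) (auto simp: r zero_power)
  also have "\<dots> = (-1) ^ Suc i * integral {-1..1} (poly (leg_base ^ n * (pderiv ^^ i) (pderiv q)))"
    using Suc.IH[of "pderiv q"] Suc.prems by (simp del: poly_mult)
  finally show ?case
    by (simp only: funpow.simps funpow_swap1 o_apply)
qed simp

text \<open>The recursion in n comes from integrating the derivative of x (x^2 - 1)^(n+1), which
  vanishes at both endpoints; x^2 is rewritten as (x^2 - 1) + 1.\<close>

lemma integral_leg_base_power:
  "integral {-1..1} (poly (leg_base ^ n)) = (-1) ^ n * 2 ^ (2 * n + 1) * (fact n)\<^sup>2 / fact (2 * n + 1)"
proof (induction n)
  case 0
  have "integral {-1..1} (poly (1::real poly)) = 2"
    using integral_pderiv[of "-1" 1 "[:0, 1:]"] by (simp add: pderiv_pCons one_pCons)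
  then show ?case by simp
next
  case (Suc n)
  have "pderiv ([:0, 1:] * leg_base ^ Suc n) =
      smult (2 * real n + 3) (leg_base ^ Suc n) + smult (2 * real n + 2) (leg_base ^ n)"
  proof (rule poly_eq_poly_eq_iff[THEN iffD1], rule ext)
    fix x
    have "pderiv leg_base = [:0, 2:]"
      by (simp add: leg_base_def pderiv_pCons)
    then show "poly (pderiv ([:0, 1:] * leg_base ^ Suc n)) x =
        poly (smult (2 * real n + 3) (leg_base ^ Suc n) + smult (2 * real n + 2) (leg_base ^ n)) x"
      by (simp add: pderiv_mult[of "[:0, 1:]"] pderiv_power_Suc pderiv_pCons algebra_simps power2_eq_square
          del: power_Suc)
        (simp add: algebra_simps)
  qed
  then have "(2 * real n + 3) * integral {-1..1} (poly (leg_base ^ Suc n)) +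
      (2 * real n + 2) * integral {-1..1} (poly (leg_base ^ n)) = 0"
    using integral_pderiv[of "-1" 1 "[:0, 1:] * leg_base ^ Suc n"]
    by (simp add: integral_poly_add integral_poly_smult)
  then have "integral {-1..1} (poly (leg_base ^ Suc n)) =
      - (2 * real n + 2) / (2 * real n + 3) * integral {-1..1} (poly (leg_base ^ n))"
    by (simp add: field_simps)
  also have "\<dots> = (-1) ^ Suc n * 2 ^ (2 * Suc n + 1) * (fact (Suc n))\<^sup>2 / fact (2 * Suc n + 1)"
  proof -
    have "fact (2 * Suc n + 1) = (2 * real n + 3) * (2 * (real n + 1)) * fact (2 * n + 1)"
      by (simp add: algebra_simps)
    moreover have "- (2 * real n + 2) / (2 * real n + 3) * (s * p * f\<^sup>2 / F) =
        - s * (p * 4) * ((real n + 1) * f)\<^sup>2 / ((2 * real n + 3) * (2 * (real n + 1)) * F)"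
      if "F > 0" for s p f F :: real
      using that by (simp add: divide_simps power2_eq_square) (simp add: algebra_simps)
    ultimately show ?thesis
      unfolding Suc by (simp add: add.commute del: fact_Suc) (simp add: add.commute)
  qed
  finally show ?case .
qed

text \<open>Rodrigues' form of the monic Legendre polynomial. It gives degree, parity and
  orthogonality at once; the agreement with the explicit sum is
  \<open>legendre_poly_eval\<close>.\<close>

definition legendre_poly :: "nat \<Rightarrow> real poly" where
  "legendre_poly n = smult (fact n / fact (2 * n)) ((pderiv ^^ n) (leg_base ^ n))"

lemma poly_higher_pderiv_reflect:
  fixes p :: "real poly"
  assumes "\<And>x. poly p (- x) = c * poly p x"
  shows "poly ((pderiv ^^ i) p) (- x) = (-1) ^ i * c * poly ((pderiv ^^ i) p) x"
proof (induction i arbitrary: x)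
  case (Suc i)
  let ?q = "(pderiv ^^ i) p"
  have "((\<lambda>x. poly ?q (- x)) has_real_derivative - poly (pderiv ?q) (- x)) (at x)"
    by (auto intro!: derivative_eq_intros DERIV_chain'[OF _ poly_DERIV])
  moreover have "((\<lambda>x. poly ?q (- x)) has_real_derivative (-1) ^ i * c * poly (pderiv ?q) x) (at x)"
    unfolding Suc by (auto intro!: derivative_eq_intros)
  ultimately show ?case
    using DERIV_unique by fastforce
qed (simp add: assms)

lemma degree_legendre_poly_le: "degree (legendre_poly n) \<le> n"
proof -
  have "degree (leg_base ^ n) \<le> 2 * n"
    using degree_power_le[of leg_base n] by (simp add: leg_base_def)
  then show ?thesis
    by (simp add: legendre_poly_def degree_higher_pderiv)
qed

text \<open>Differentiating x^(2n) n times produces the Pochhammer symbol (n+1)_n = (2n)!/n!, which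
  the normalizing factor cancels.\<close>

lemma coeff_legendre_poly [simp]: "coeff (legendre_poly n) n = 1"
proof -
  have "coeff (leg_base ^ n) (2 * n) = 1"
    using lead_coeff_power[of leg_base n] by (simp add: leg_base_def degree_power_eq mult_2 mult_2_right)
  moreover have "fact (2 * n) = fact n * pochhammer (real n + 1) n"
    using pochhammer_product'[of "1 :: real" n n]
    by (simp add: pochhammer_fact mult_2 add.commute)
  moreover have "pochhammer (real n + 1) n > 0"
    by (intro pochhammer_pos) auto
  ultimately show ?thesis
    by (simp add: legendre_poly_def coeff_higher_pderiv mult_2 add.commute)
qed

lemma legendre_poly_reflect: "poly (legendre_poly n) (- x) = (-1) ^ n * poly (legendre_poly n) x"
  using poly_higher_pderiv_reflect[of "leg_base ^ n" 1 n x] by (simp add: legendre_poly_def)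

text \<open>With y = (x - 1)/2 one has x^2 - 1 = 4 y (y + 1). The binomial theorem expands the n-th
  power in y^(n+k), and n derivatives termwise, each with a chain-rule factor 1/2, give the defining
  sum.\<close>

lemma legendre_poly_eval: "poly (legendre_poly n) x = monic_legendre n x"
proof -
  let ?y = "[:-1/2, 1/2:] :: real poly"
  have "leg_base ^ n = (\<Sum>k\<le>n. smult (4 ^ n * real (n choose k)) (?y ^ (n + k)))"
  proof (rule poly_eq_poly_eq_iff[THEN iffD1], rule ext)
    fix x :: real
    define u where "u = (x - 1) / 2"
    have "poly leg_base x = 4 * (u * (u + 1))" and y: "poly ?y x = u"
      by (simp_all add: u_def field_simps power2_eq_square)
    then show "poly (leg_base ^ n) x = poly (\<Sum>k\<le>n. smult (4 ^ n * real (n choose k)) (?y ^ (n + k))) x"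
      by (simp only: poly_power poly_sum poly_smult power_mult_distrib binomial_ring)
        (simp add: sum_distrib_left power_add algebra_simps)
  qed
  moreover have "(pderiv ^^ i) (?y ^ m) = smult (fact m / fact (m - i) / 2 ^ i) (?y ^ (m - i))"
    if "i \<le> m" for i m
    using that
  proof (induction i)
    case (Suc i)
    then obtain l where l: "m - i = Suc l"
      by (metis Suc_diff_Suc Suc_le_lessD)
    moreover from l have "m - Suc i = l"
      by simp
    ultimately show ?case
      using Suc by (simp add: pderiv_smult pderiv_power_Suc pderiv_pCons fact_Suc del: power_Suc)
        (simp add: field_simps)
  qed simp
  ultimately have "poly (legendre_poly n) x = fact n / fact (2 * n) *
      (\<Sum>k\<le>n. 4 ^ n * real (n choose k) * (fact (n + k) / fact k / 2 ^ n * ((x - 1) / 2) ^ k))"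
    by (simp add: legendre_poly_def higher_pderiv_sum higher_pderiv_smult poly_sum diff_divide_distrib mult.assoc)
  also have "\<dots> = monic_legendre n x"
    unfolding monic_legendre_def sum_distrib_left atMost_atLeast0
  proof (rule sum.cong)
    fix k assume "k \<in> {0..n}"
    have "(4::real) ^ n = 2 ^ n * 2 ^ n"
      by (simp flip: power_mult_distrib)
    then show "fact n / fact (2 * n) * (4 ^ n * real (n choose k) * (fact (n + k) / fact k / 2 ^ n * ((x - 1) / 2) ^ k)) =
         2 ^ n / real (2 * n choose n) * (real (n choose k) * real (n + k choose k) * ((x - 1) / 2) ^ k)"
      by (simp add: binomial_fact field_simps mult_2)
  qed simp
  finally show ?thesis .
qed

text \<open>After n integrations by parts q is reduced to the constant n! times its n-th
  coefficient, and the integral of \<open>leg_base ^ n\<close> remains. This covers both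
  orthogonality to lower degrees and the norm.\<close>

lemma integral_legendre_poly_mult:
  assumes "degree q \<le> n"
  shows "integral {-1..1} (poly (legendre_poly n * q)) = coeff q n * legendre_h n"
proof -
  have "degree ((pderiv ^^ n) q) = 0"
    using assms by (simp add: degree_higher_pderiv)
  moreover have "coeff ((pderiv ^^ n) q) 0 = fact n * coeff q n"
    by (simp add: coeff_higher_pderiv pochhammer_fact)
  ultimately have D: "(pderiv ^^ n) q = [:fact n * coeff q n:]"
    by (metis degree_eq_zeroE coeff_pCons_0)
  have "integral {-1..1} (poly (legendre_poly n * q)) =
      fact n / fact (2 * n) * ((-1) ^ n * (fact n * coeff q n * integral {-1..1} (poly (leg_base ^ n))))"
    using integral_rodrigues[of n n q] by (simp add: legendre_poly_def integral_poly_smult D)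
  also have "\<dots> = coeff q n * legendre_h n"
  proof -
    have f: "fact (2 * n + 1) = (2 * real n + 1) * fact (2 * n)"
      by (simp add: algebra_simps)
    have c: "real (2 * n choose n) = fact (2 * n) / (fact n * fact n)"
      by (simp add: binomial_fact mult_2)
    \<comment> \<open>The factorials become free variables, so that only an identity of rational
      functions is left.\<close>
    have "fn / F * (g * (fn * cf * (g * p * fn\<^sup>2 / (k * F)))) =
        cf * (p / (k * (F / (fn * fn))\<^sup>2)) * (g * g)" if "fn > 0" "F > 0" "k > 0"
      for fn F p cf k g :: real
      using that by (simp add: field_simps power2_eq_square)
    moreover have "(-1) ^ n * (-1) ^ n = (1 :: real)"
      by (simp flip: power_mult_distrib)
    ultimately show ?thesis
      unfolding integral_leg_base_power legendre_h_def f c by simp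
  qed
  finally show ?thesis .
qed

text \<open>No summand is negative and the one for k = 0 is 1. This is applied at 1/gamma, so that
  the quotient of Legendre values there has a nonzero denominator.\<close>

lemma monic_legendre_pos: "monic_legendre n x > 0" if "x \<ge> 1"
proof -
  have "0 < (\<Sum>k=0..n. real (n choose k) * real ((n + k) choose k) * ((x - 1) / 2) ^ k)"
    using that by (intro sum_pos2[of _ 0]) auto
  then show ?thesis
    by (simp add: monic_legendre_def)
qed

subsection \<open>Moments on the arc\<close>

fun chebyshev_U :: "nat \<Rightarrow> real poly" where
  "chebyshev_U 0 = 1"
| "chebyshev_U (Suc 0) = [:0, 2:]"
| "chebyshev_U (Suc (Suc m)) = [:0, 2:] * chebyshev_U (Suc m) - chebyshev_U m"

lemma sin_Suc_mult: "sin (real (Suc m) * \<phi>) = sin \<phi> * poly (chebyshev_U m) (cos \<phi>)"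
proof (induction m rule: chebyshev_U.induct)
  case 2
  show ?case
    using sin_double[of \<phi>] by simp
next
  case (3 m)
  have "sin (real (Suc (Suc (Suc m))) * \<phi>) + sin (real (Suc m) * \<phi>) =
      2 * cos \<phi> * sin (real (Suc (Suc m)) * \<phi>)"
    using sin_add[of "real (Suc (Suc m)) * \<phi>" \<phi>] sin_diff[of "real (Suc (Suc m)) * \<phi>" \<phi>]
    by (simp add: algebra_simps)
  then show ?case
    using 3 by (simp add: algebra_simps)
qed simp

lemma degree_chebyshev_U_le: "degree (chebyshev_U m) \<le> m"
proof (induction m rule: chebyshev_U.induct)
  case (3 m)
  have "degree ([:0, 2:] * chebyshev_U (Suc m)) \<le> Suc (Suc m)"
    using degree_mult_le[of "[:0, 2:]" "chebyshev_U (Suc m)"] 3 by simp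
  then show ?case
    using 3 unfolding chebyshev_U.simps by (intro degree_diff_le) auto
qed auto

lemma coeff_chebyshev_U: "coeff (chebyshev_U m) m = 2 ^ m"
  by (induction m rule: chebyshev_U.induct) (auto simp: coeff_eq_0 le_less_trans[OF degree_chebyshev_U_le])

section \<open>Half-integer powers of z and the substitution for x\<close>

lemma zhalf_eq_cis: "zhalf k \<theta> = cis (of_int k * \<theta> / 2)"
  by (simp add: zhalf_def cis_conv_exp mult_ac)

lemma zhalf_add: "zhalf (k + l) \<theta> = zhalf k \<theta> * zhalf l \<theta>"
  by (simp add: zhalf_eq_cis cis_mult add_divide_distrib distrib_right)

lemma zhalf_0 [simp]: "zhalf 0 \<theta> = 1"
  by (simp add: zhalf_def)

lemma cis_power_eq_zhalf: "cis \<theta> ^ n = zhalf (2 * int n) \<theta>"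
  by (simp add: zhalf_eq_cis Complex.DeMoivre)

text \<open>Pulling out z^(1/2) leaves a multiple of sin (theta/2). This is how a factor z - 1 is
  traded against either weight, at the price of a shift by a half power.\<close>

lemma cis_minus_1: "cis \<theta> - 1 = 2 * \<i> * of_real (sin (\<theta> / 2)) * zhalf 1 \<theta>"
  using cos_double_sin[of "\<theta> / 2"] sin_double[of "\<theta> / 2"]
  by (simp add: zhalf_eq_cis complex_eq_iff power2_eq_square)

lemma cis_plus_1: "cis \<theta> + 1 = 2 * of_real (cos (\<theta> / 2)) * zhalf 1 \<theta>"
  using cos_double_cos[of "\<theta> / 2"] sin_double[of "\<theta> / 2"]
  by (simp add: zhalf_eq_cis complex_eq_iff power2_eq_square)

lemma gam_pos: "0 < gam \<alpha>" if "0 \<le> \<alpha>" "\<alpha> < pi"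
  using that unfolding gam_def by (intro cos_gt_zero_pi) auto

text \<open>An antiderivative q of p makes -2 gamma q(x) an antiderivative of the integrand, and x
  runs from 1 to -1 along the arc.\<close>

lemma arc_integral_substitution:
  assumes "0 \<le> \<alpha>" "\<alpha> < pi"
  shows "integral {\<alpha>..2 * pi - \<alpha>} (\<lambda>\<theta>. sin (\<theta> / 2) * poly p (arc_x \<alpha> \<theta>)) =
    2 * gam \<alpha> * integral {-1..1} (poly p)"
proof -
  obtain q where q: "p = pderiv q"
    using poly_antiderivative by metis
  have g: "gam \<alpha> > 0"
    using gam_pos assms by blast
  have "((\<lambda>\<theta>. - 2 * gam \<alpha> * poly q (arc_x \<alpha> \<theta>)) has_real_derivative
      sin (\<theta> / 2) * poly p (arc_x \<alpha> \<theta>)) (at \<theta> within S)" for \<theta> S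
    unfolding arc_x_def q using g
    by (auto intro!: derivative_eq_intros DERIV_chain2[OF poly_DERIV] simp: field_simps)
  then have "integral {\<alpha>..2 * pi - \<alpha>} (\<lambda>\<theta>. sin (\<theta> / 2) * poly p (arc_x \<alpha> \<theta>)) =
      - 2 * gam \<alpha> * poly q (arc_x \<alpha> (2 * pi - \<alpha>)) - (- 2 * gam \<alpha> * poly q (arc_x \<alpha> \<alpha>))"
    using assms
    by (intro integral_unique fundamental_theorem_of_calculus)
      (auto simp flip: has_real_derivative_iff_has_vector_derivative)
  moreover have "arc_x \<alpha> \<alpha> = 1" "arc_x \<alpha> (2 * pi - \<alpha>) = -1"
    using g by (auto simp: arc_x_def gam_def diff_divide_distrib)
  ultimately show ?thesis
    by (simp add: q integral_pderiv algebra_simps)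
qed

text \<open>After the substitution L_m is integrated against U_j(gamma x), of degree at most j. Only
  j = m contributes, with leading coefficient (2 gamma)^m; the substitution supplies one more factor
  2 gamma.\<close>

lemma integral_sin_legendre:
  assumes "0 \<le> \<alpha>" "\<alpha> < pi" "j \<le> m"
  shows "integral {\<alpha>..2 * pi - \<alpha>} (\<lambda>\<theta>. sin (real (Suc j) * \<theta> / 2) * monic_legendre m (arc_x \<alpha> \<theta>)) =
    (if j = m then (2 * gam \<alpha>) ^ Suc m * legendre_h m else 0)"
proof -
  define q where "q = chebyshev_U j \<circ>\<^sub>p [:0, gam \<alpha>:]"
  have g: "gam \<alpha> > 0"
    using gam_pos assms by blast
  have "sin (real (Suc j) * \<theta> / 2) * monic_legendre m (arc_x \<alpha> \<theta>) =
      sin (\<theta> / 2) * poly (legendre_poly m * q) (arc_x \<alpha> \<theta>)" for \<theta>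
    using sin_Suc_mult[of j "\<theta> / 2"] g
    by (simp add: q_def poly_pcompose arc_x_def legendre_poly_eval)
  moreover have "degree q \<le> j"
    using degree_pcompose_le[of "chebyshev_U j" "[:0, gam \<alpha>:]"] degree_chebyshev_U_le[of j] g
    by (simp add: q_def)
  moreover from this have "coeff q m = (if j = m then (2 * gam \<alpha>) ^ m else 0)"
    using assms by (auto simp: coeff_eq_0) (auto simp: q_def coeff_pcompose_linear coeff_chebyshev_U power_mult_distrib)
  ultimately show ?thesis
    using assms by (simp add: arc_integral_substitution integral_legendre_poly_mult del: poly_mult)
qed

lemma continuous_on_arc [continuous_intros]:
  "continuous_on S (zhalf k)"
  "continuous_on S (arc_x \<alpha>)"
  "continuous_on S (\<lambda>\<theta>. monic_legendre m (arc_x \<alpha> \<theta>))"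
proof -
  show *: "continuous_on S (arc_x \<alpha>)"
    unfolding arc_x_def divide_inverse[of _ "gam \<alpha>"] by (intro continuous_intros) auto
  show "continuous_on S (zhalf k)"
    unfolding zhalf_eq_cis by (intro continuous_intros) auto
  show "continuous_on S (\<lambda>\<theta>. monic_legendre m (arc_x \<alpha> \<theta>))"
    unfolding legendre_poly_eval[symmetric] using * by (intro continuous_intros)
qed

lemma monic_legendre_minus: "monic_legendre n (- x) = (-1) ^ n * monic_legendre n x"
  using legendre_poly_reflect by (simp flip: legendre_poly_eval)

lemma arc_x_reflect: "arc_x \<alpha> (2 * pi - \<theta>) = - arc_x \<alpha> \<theta>"
  by (simp add: arc_x_def diff_divide_distrib)

lemma integral_reflect_midpoint:
  fixes f :: "real \<Rightarrow> real"
  assumes "f integrable_on {a..b}"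
  shows "integral {a..b} (\<lambda>x. f (a + b - x)) = integral {a..b} f"
proof -
  have "((\<lambda>x. f (- x)) has_integral integral {a..b} f) (cbox (- b) (- a))"
    using has_integral_reflect_real[of f "integral {a..b} f" b a] integrable_integral[OF assms] by simp
  from has_integral_affinity'[OF this, of 1 "- (a + b)"] show ?thesis
    by (intro integral_unique) (simp add: add.commute)
qed

text \<open>Under reflection of the arc the cosine picks up (-1)^k and L_m picks up (-1)^m; since k
  + m is odd, the integral equals its own negative.\<close>

lemma integral_cos_legendre:
  assumes "odd (k + int m)"
  shows "integral {\<alpha>..2 * pi - \<alpha>} (\<lambda>\<theta>. cos (of_int k * \<theta> / 2) * monic_legendre m (arc_x \<alpha> \<theta>)) = 0"
    (is "integral _ ?f = 0")
proof -
  have "integral {\<alpha>..2 * pi - \<alpha>} (\<lambda>\<theta>. ?f (\<alpha> + (2 * pi - \<alpha>) - \<theta>)) = integral {\<alpha>..2 * pi - \<alpha>} ?f"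
    by (intro integral_reflect_midpoint integrable_continuous_interval continuous_intros) auto
  moreover have "?f (2 * pi - \<theta>) = - ?f \<theta>" for \<theta>
  proof -
    have "cos (of_int k * (2 * pi - \<theta>) / 2) = (if even k then 1 else -1) * cos (of_int k * \<theta> / 2)"
      using cos_diff[of "of_int k * pi" "of_int k * \<theta> / 2"]
      by (simp add: algebra_simps diff_divide_distrib)
    then show ?thesis
      using assms by (auto simp: arc_x_reflect monic_legendre_minus)
  qed
  ultimately show ?thesis
    by simp
qed

lemma integral_zhalf_legendre:
  assumes "0 \<le> \<alpha>" "\<alpha> < pi" "\<bar>k\<bar> \<le> int m + 1" "odd (k + int m)"
  shows "integral {\<alpha>..2 * pi - \<alpha>} (\<lambda>\<theta>. zhalf k \<theta> * of_real (monic_legendre m (arc_x \<alpha> \<theta>))) =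
    \<i> * of_real ((if k = int m + 1 then 1 else if k = - (int m + 1) then -1 else 0) *
      (2 * gam \<alpha>) ^ Suc m * legendre_h m)"
proof -
  let ?I = "{\<alpha>..2 * pi - \<alpha>}" and ?L = "\<lambda>\<theta>. monic_legendre m (arc_x \<alpha> \<theta>)"
  have s: "integral ?I (\<lambda>\<theta>. sin (of_int k * \<theta> / 2) * ?L \<theta>) =
     (if k = int m + 1 then 1 else if k = - (int m + 1) then -1 else 0) *
      (2 * gam \<alpha>) ^ Suc m * legendre_h m"
  proof -
    \<comment> \<open>The sine moments are known for positive multiples only; the sine vanishes for
      k = 0, and negative k follow from its oddness.\<close>
    consider (0) "k = 0" | (pos) j where "k = int (Suc j)" | (neg) j where "k = - int (Suc j)"
      by (metis int_cases3 not0_implies_Suc of_nat_0_less_iff less_numeral_extra(3))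
    then show ?thesis
    proof cases
      case pos
      then show ?thesis
        using integral_sin_legendre[of \<alpha> j m] assms by auto
    next
      case neg
      then have "sin (of_int k * \<theta> / 2) = - sin (real (Suc j) * \<theta> / 2)" for \<theta>
      proof -
        have "of_int k * \<theta> / 2 = - (real (Suc j) * \<theta> / 2)"
          by (simp add: neg field_simps)
        then show ?thesis
          by (simp only: sin_minus)
      qed
      then show ?thesis
        using integral_sin_legendre[of \<alpha> j m] assms neg by auto
    qed auto
  qed
  have "(\<lambda>\<theta>. zhalf k \<theta> * of_real (?L \<theta>)) integrable_on ?I"
    by (intro integrable_continuous_interval continuous_intros)
  note * = integrable_integral[OF this]
  have "Re (integral ?I (\<lambda>\<theta>. zhalf k \<theta> * of_real (?L \<theta>))) = 0"
    "Im (integral ?I (\<lambda>\<theta>. zhalf k \<theta> * of_real (?L \<theta>))) =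
     (if k = int m + 1 then 1 else if k = - (int m + 1) then -1 else 0) *
      (2 * gam \<alpha>) ^ Suc m * legendre_h m"
    using has_integral_Re[OF *] has_integral_Im[OF *] integral_cos_legendre[OF assms(4), of \<alpha>] s
    by (auto simp: zhalf_eq_cis dest!: integral_unique)
  moreover have "z = \<i> * of_real r" if "Re z = 0" "Im z = r" for z r
    using that by (simp add: complex_eq_iff)
  ultimately show ?thesis
    by blast
qed

text \<open>The polynomial A_n, built termwise: since 1 + z = 2 gamma x z^(1/2), the monomial x^k of
  L_n turns into (2 gamma)^(n-k) z^((n-k)/2) (1 + z)^k. The halving is exact wherever the
  coefficient of L_n is nonzero.\<close>

definition arc_legendre :: "real \<Rightarrow> nat \<Rightarrow> complex poly" where
  "arc_legendre \<alpha> n = (\<Sum>k\<le>n. smult (of_real (coeff (legendre_poly n) k * (2 * gam \<alpha>) ^ (n - k)))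
     (monom 1 ((n - k) div 2) * [:1, 1:] ^ k))"

text \<open>Compare coefficients in L_n(-x) = (-1)^n L_n(x). This removes the terms of A_n in which
  \<open>div\<close> would round.\<close>

lemma coeff_legendre_poly_parity:
  assumes "odd (n + k)"
  shows "coeff (legendre_poly n) k = 0"
proof -
  have "legendre_poly n \<circ>\<^sub>p [:0, -1:] = smult ((-1) ^ n) (legendre_poly n)"
    by (rule poly_eq_poly_eq_iff[THEN iffD1]) (simp add: fun_eq_iff poly_pcompose legendre_poly_reflect)
  then have "(-1) ^ k * coeff (legendre_poly n) k = (-1) ^ n * coeff (legendre_poly n) k"
    by (metis coeff_pcompose_linear coeff_smult)
  then show ?thesis
    using assms by (auto simp: minus_one_power_iff split: if_splits)
qed

lemma poly_arc_legendre:
  assumes "gam \<alpha> \<noteq> 0"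
  shows "poly (arc_legendre \<alpha> n) (cis \<theta>) =
    of_real (2 * gam \<alpha>) ^ n * zhalf (int n) \<theta> * of_real (monic_legendre n (arc_x \<alpha> \<theta>))"
proof -
  let ?c = "coeff (legendre_poly n)" and ?g = "2 * gam \<alpha>" and ?x = "arc_x \<alpha> \<theta>"
  have "of_real (?c k * ?g ^ (n - k)) * (cis \<theta> ^ ((n - k) div 2) * (1 + cis \<theta>) ^ k) =
      of_real ?g ^ n * zhalf (int n) \<theta> * of_real (?c k * ?x ^ k)" if "k \<le> n" for k
  proof (cases "odd (n + k)")
    case False
    then have "even (n - k)"
      using that by simp
    then obtain l where "n - k = 2 * l"
      by (rule evenE)
    then have n: "n = 2 * l + k"
      using that by simp
    have "1 + cis \<theta> = of_real (?g * ?x) * zhalf 1 \<theta>"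
      using cis_plus_1[of \<theta>] assms by (simp add: arc_x_def add.commute)
    moreover have "zhalf 1 \<theta> ^ k = zhalf (int k) \<theta>"
      by (simp add: zhalf_eq_cis Complex.DeMoivre)
    ultimately show ?thesis
      by (simp add: n cis_power_eq_zhalf zhalf_add power_mult_distrib power_add mult_ac)
  qed (simp add: coeff_legendre_poly_parity)
  then have "poly (arc_legendre \<alpha> n) (cis \<theta>) =
      of_real ?g ^ n * zhalf (int n) \<theta> * of_real (\<Sum>k\<le>n. ?c k * ?x ^ k)"
    unfolding arc_legendre_def of_real_sum sum_distrib_left poly_sum
    by (intro sum.cong) (simp_all add: poly_monom add.commute[of 1])
  also have "(\<Sum>k\<le>n. ?c k * ?x ^ k) = monic_legendre n ?x"
    using arg_cong[OF poly_as_sum_of_monoms'[OF degree_legendre_poly_le, of n], of "\<lambda>p. poly p ?x"]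
    by (simp add: poly_sum poly_monom legendre_poly_eval)
  finally show ?thesis .
qed

text \<open>The term k = n is (1 + z)^n, which is monic; for k < n the degree is at most (n - k)/2 +
  k < n.\<close>

lemma arc_legendre_monic:
  "degree (arc_legendre \<alpha> n) = n" "coeff (arc_legendre \<alpha> n) n = 1"
proof -
  let ?t = "\<lambda>k. smult (of_real (coeff (legendre_poly n) k * (2 * gam \<alpha>) ^ (n - k)))
     (monom 1 ((n - k) div 2) * [:1, 1:] ^ k) :: complex poly"
  have deg: "degree (?t k) < n" if "k < n" for k
  proof -
    have "degree (?t k) \<le> (n - k) div 2 + k"
      by (intro order_trans[OF degree_smult_le] order_trans[OF degree_mult_le] add_mono
          order_trans[OF degree_power_le]) (auto simp: degree_monom_eq)
    then show ?thesis
      using that by linarith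
  qed
  have *: "arc_legendre \<alpha> n = (\<Sum>k<n. ?t k) + [:1, 1:] ^ n"
    unfolding arc_legendre_def lessThan_Suc_atMost[symmetric] sum.lessThan_Suc by simp
  have "coeff ([:1, 1:] ^ n :: complex poly) n = 1"
    using lead_coeff_power[of "[:1, 1:] :: complex poly" n] by (simp add: degree_power_eq)
  moreover have "coeff (\<Sum>k<n. ?t k) n = 0"
    using deg by (simp add: coeff_sum coeff_eq_0 del: coeff_smult)
  ultimately show c: "coeff (arc_legendre \<alpha> n) n = 1"
    by (simp add: *)
  have "degree (\<Sum>k<n. ?t k) \<le> n"
    using deg by (intro degree_sum_le less_imp_le) auto
  moreover have "degree ([:1, 1:] ^ n :: complex poly) \<le> n"
    by (simp add: degree_power_eq)
  ultimately have "degree (arc_legendre \<alpha> n) \<le> n"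
    unfolding * by (rule degree_add_le)
  moreover have "n \<le> degree (arc_legendre \<alpha> n)"
    using c by (intro le_degree) simp
  ultimately show "degree (arc_legendre \<alpha> n) = n"
    by simp
qed

subsection \<open>Uniqueness of orthogonal polynomials on the circle\<close>

text \<open>Strip leading terms with a monic basis, one degree at a time. It serves for the
  orthogonal polynomials and for the monomials. Vanishing coefficients from n on express "degree
  below n" in a way that also fits n = 0.\<close>

lemma monic_basis_induct [consumes 3, case_names zero step]:
  fixes B :: "nat \<Rightarrow> 'a :: comm_ring_1 poly"
  assumes "\<And>k. degree (B k) = k" "\<And>k. lead_coeff (B k) = 1"
    and "\<And>i. i \<ge> n \<Longrightarrow> coeff p i = 0"
    and "P 0" "\<And>q c k. k < n \<Longrightarrow> P q \<Longrightarrow> P (q + smult c (B k))"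
  shows "P p"
proof -
  have "P p" if "\<And>i. i \<ge> m \<Longrightarrow> coeff p i = 0" "m \<le> n" for m p
    using that
  proof (induction m arbitrary: p)
    case 0
    then have "p = 0"
      by (simp add: poly_eq_iff)
    then show ?case
      using assms(4) by simp
  next
    case (Suc m)
    define q where "q = p - smult (coeff p m) (B m)"
    have "coeff q i = 0" if "i \<ge> m" for i
    proof (cases "i = m")
      case True
      then show ?thesis
        using assms(1,2)[of m] by (simp add: q_def)
    next
      case False
      then show ?thesis
        using Suc.prems(1)[of i] assms(1)[of m] that by (simp add: q_def coeff_eq_0)
    qed
    then have "P q"
      using Suc by simp
    then have "P (q + smult (coeff p m) (B m))"
      using Suc.prems assms(5) by simp
    then show ?case
      by (simp add: q_def)
  qed
  then show ?thesis
    using assms(3) by blast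
qed

definition circle_inner :: "(real \<Rightarrow> real) \<Rightarrow> complex poly \<Rightarrow> complex poly \<Rightarrow> complex" where
  "circle_inner f p q =
     integral {0..2 * pi} (\<lambda>\<theta>. poly p (cis \<theta>) * cnj (poly q (cis \<theta>)) * of_real (f \<theta>))"

text \<open>Integrability is assumed because \<open>integral\<close> is 0 by convention on
  nonintegrable functions, so that linearity of the inner product depends on it.\<close>

locale opuc =
  fixes f :: "real \<Rightarrow> real" and \<Phi> :: "nat \<Rightarrow> complex poly" and chi :: "nat \<Rightarrow> real"
  assumes monic_opuc: "monic_opuc f \<Phi> chi"
    and integrable: "\<And>p q. (\<lambda>\<theta>. poly p (cis \<theta>) * cnj (poly q (cis \<theta>)) * of_real (f \<theta>)) integrable_on {0..2 * pi}"
begin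

lemma degree_opuc: "degree (\<Phi> n) = n" and lead_coeff_opuc: "lead_coeff (\<Phi> n) = 1"
  and chi_nonzero: "chi n \<noteq> 0"
  and inner_opuc: "circle_inner f (\<Phi> n) (\<Phi> m) = (if m = n then 2 * pi / (chi n)\<^sup>2 else 0)"
proof -
  show "degree (\<Phi> n) = n" "lead_coeff (\<Phi> n) = 1" "chi n \<noteq> 0"
    using monic_opuc unfolding monic_opuc_def by blast+
  have "1 / (2 * of_real pi) * circle_inner f (\<Phi> n) (\<Phi> m) = (if m = n then 1 / (of_real (chi n))\<^sup>2 else 0)"
    using monic_opuc unfolding monic_opuc_def circle_inner_def by blast
  then show "circle_inner f (\<Phi> n) (\<Phi> m) = (if m = n then 2 * pi / (chi n)\<^sup>2 else 0)"
    by (simp add: field_simps split: if_splits)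
qed

lemma inner_add_smult_left:
  "circle_inner f (p + smult c q) r = circle_inner f p r + c * circle_inner f q r"
proof -
  have "circle_inner f (p + smult c q) r = integral {0..2 * pi} (\<lambda>\<theta>.
      poly p (cis \<theta>) * cnj (poly r (cis \<theta>)) * of_real (f \<theta>) +
      c * (poly q (cis \<theta>) * cnj (poly r (cis \<theta>)) * of_real (f \<theta>)))"
    unfolding circle_inner_def by (simp add: algebra_simps)
  then show ?thesis
    unfolding circle_inner_def
    by (subst (asm) Henstock_Kurzweil_Integration.integral_add) (auto intro: integrable integrable_on_mult_right)
qed

lemma inner_add_smult_right:
  "circle_inner f p (q + smult c r) = circle_inner f p q + cnj c * circle_inner f p r"
proof -
  have "circle_inner f p (q + smult c r) = integral {0..2 * pi} (\<lambda>\<theta>.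
      poly p (cis \<theta>) * cnj (poly q (cis \<theta>)) * of_real (f \<theta>) +
      cnj c * (poly p (cis \<theta>) * cnj (poly r (cis \<theta>)) * of_real (f \<theta>)))"
    unfolding circle_inner_def by (simp add: algebra_simps)
  then show ?thesis
    unfolding circle_inner_def
    by (subst (asm) Henstock_Kurzweil_Integration.integral_add) (auto intro: integrable integrable_on_mult_right)
qed

lemma inner_diff_smult_left:
  "circle_inner f (p - smult c q) r = circle_inner f p r - c * circle_inner f q r"
  using inner_add_smult_left[of p "- c" q r] by simp

lemma inner_0 [simp]: "circle_inner f 0 p = 0" "circle_inner f p 0 = 0"
  by (simp_all add: circle_inner_def)

lemma inner_lower:
  assumes "\<And>i. i \<ge> n \<Longrightarrow> coeff p i = 0"
  shows "circle_inner f (\<Phi> n) p = 0" "circle_inner f p (\<Phi> n) = 0"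
proof -
  show "circle_inner f (\<Phi> n) p = 0"
    using degree_opuc lead_coeff_opuc assms
    by (induction p rule: monic_basis_induct) (auto simp: inner_add_smult_right inner_opuc)
  show "circle_inner f p (\<Phi> n) = 0"
    using degree_opuc lead_coeff_opuc assms
    by (induction p rule: monic_basis_induct) (auto simp: inner_add_smult_left inner_opuc)
qed

text \<open>If p had degree d < n, then p would be its leading coefficient times
  \<open>\<Phi> d\<close> plus lower terms, which are orthogonal to \<open>\<Phi> d\<close>. Pairing
  p with \<open>\<Phi> d\<close> would thus give a nonzero value, although p is orthogonal to all
  monomials below n.\<close>

lemma inner_nondegenerate:
  assumes "\<And>i. i \<ge> n \<Longrightarrow> coeff p i = 0" "\<And>j. j < n \<Longrightarrow> circle_inner f p (monom 1 j) = 0"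
  shows "p = 0"
proof (rule ccontr)
  assume "p \<noteq> 0"
  define d where "d = degree p"
  define q where "q = p - smult (lead_coeff p) (\<Phi> d)"
  have "d < n"
    using assms(1)[of d] \<open>p \<noteq> 0\<close> by (force simp: d_def)
  have "circle_inner f p r = 0" if "\<And>i. i \<ge> n \<Longrightarrow> coeff r i = 0" for r
    using degree_monom_eq[OF one_neq_zero] lead_coeff_monom that
    by (induction r rule: monic_basis_induct) (auto simp: inner_add_smult_right intro: assms(2))
  then have "circle_inner f p (\<Phi> d) = 0"
    using \<open>d < n\<close> degree_opuc[of d] by (simp add: coeff_eq_0)
  moreover have "circle_inner f q (\<Phi> d) = 0"
  proof (rule inner_lower)
    fix i assume "d \<le> i"
    then show "coeff q i = 0"
      using degree_opuc[of d] lead_coeff_opuc[of d]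
      by (cases "i = d") (auto simp: q_def d_def coeff_eq_0)
  qed
  ultimately have "lead_coeff p * (2 * pi / (chi d)\<^sup>2) = 0"
    using inner_add_smult_left[of q "lead_coeff p" "\<Phi> d" "\<Phi> d"] by (simp add: q_def inner_opuc)
  then show False
    using \<open>p \<noteq> 0\<close> chi_nonzero by simp
qed

text \<open>The difference of p and \<open>\<Phi> n\<close> has degree below n and is orthogonal to
  all lower monomials, hence is zero. As z^n minus \<open>\<Phi> n\<close> is of lower degree too,
  pairing with z^n already gives the squared norm.\<close>

lemma opuc_unique:
  assumes "degree p = n" "lead_coeff p = 1" "\<And>j. j < n \<Longrightarrow> circle_inner f p (monom 1 j) = 0"
  shows "\<Phi> n = p" "circle_inner f p (monom 1 n) = 2 * pi / (chi n)\<^sup>2"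
proof -
  have low: "coeff (q - \<Phi> n) i = 0" if "i \<ge> n" "degree q = n" "lead_coeff q = 1" for q i
    using that degree_opuc[of n] lead_coeff_opuc[of n] by (cases "i = n") (auto simp: coeff_eq_0)
  have monom: "circle_inner f (\<Phi> n) (monom 1 j) = 0" if "j < n" for j
    using that by (intro inner_lower) auto
  have "p - \<Phi> n = 0"
    using inner_diff_smult_left[of p 1 "\<Phi> n"] assms low monom
    by (intro inner_nondegenerate) auto
  then show p: "\<Phi> n = p"
    by simp
  have "circle_inner f (\<Phi> n) (monom 1 n - \<Phi> n) = 0"
    by (intro inner_lower low) (auto simp: degree_monom_eq)
  then show "circle_inner f p (monom 1 n) = 2 * pi / (chi n)\<^sup>2"
    using inner_add_smult_right[of "\<Phi> n" "monom 1 n - \<Phi> n" 1 "\<Phi> n"] inner_opuc[of n n]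
    by (simp add: p)
qed

end

subsection \<open>The two weights\<close>

definition arc_moment :: "real \<Rightarrow> int \<Rightarrow> nat \<Rightarrow> complex" where
  "arc_moment \<alpha> k m =
     integral {\<alpha>..2 * pi - \<alpha>} (\<lambda>\<theta>. zhalf k \<theta> * of_real (monic_legendre m (arc_x \<alpha> \<theta>)))"

lemma cnj_zhalf: "cnj (zhalf k \<theta>) = zhalf (- k) \<theta>"
  by (simp add: zhalf_eq_cis cis_cnj)

lemma sin_half_pos: "0 < sin (\<theta> / 2)" if "0 < \<alpha>" "\<theta> \<in> {\<alpha>..2 * pi - \<alpha>}"
  using that by (intro sin_gt_zero) auto

text \<open>The weight may jump at the ends of the arc, so integrability over the full circle is
  obtained from continuity on the closed arc and extension by zero.\<close>

lemma circle_inner_arc_weight: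
  assumes "0 \<le> \<alpha>" "continuous_on {\<alpha>..2 * pi - \<alpha>} w"
    and w: "\<And>\<theta>. \<theta> \<notin> {\<alpha>..2 * pi - \<alpha>} \<Longrightarrow> w \<theta> = 0"
  shows "(\<lambda>\<theta>. poly p (cis \<theta>) * cnj (poly q (cis \<theta>)) * of_real (w \<theta>)) integrable_on {0..2 * pi}"
    and "circle_inner w p q = integral {\<alpha>..2 * pi - \<alpha>}
      (\<lambda>\<theta>. poly p (cis \<theta>) * cnj (poly q (cis \<theta>)) * of_real (w \<theta>))"
proof -
  let ?F = "\<lambda>\<theta>. poly p (cis \<theta>) * cnj (poly q (cis \<theta>)) * complex_of_real (w \<theta>)"
  have "continuous_on {\<alpha>..2 * pi - \<alpha>} ?F"
    using assms(2) by (intro continuous_intros)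
  then have "(?F has_integral integral {\<alpha>..2 * pi - \<alpha>} ?F) (cbox \<alpha> (2 * pi - \<alpha>))"
    using integrable_integral[OF integrable_continuous_interval] by simp
  moreover have "cbox \<alpha> (2 * pi - \<alpha>) \<subseteq> cbox 0 (2 * pi)"
    using assms(1) by auto
  ultimately have "((\<lambda>\<theta>. if \<theta> \<in> cbox \<alpha> (2 * pi - \<alpha>) then ?F \<theta> else 0) has_integral
      integral {\<alpha>..2 * pi - \<alpha>} ?F) (cbox 0 (2 * pi))"
    by (rule has_integral_restrict_closed_subinterval)
  moreover have "(\<lambda>\<theta>. if \<theta> \<in> cbox \<alpha> (2 * pi - \<alpha>) then ?F \<theta> else 0) = ?F"
    using w by (auto simp: fun_eq_iff)
  ultimately have "(?F has_integral integral {\<alpha>..2 * pi - \<alpha>} ?F) {0..2 * pi}"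
    by simp
  then show "?F integrable_on {0..2 * pi}" "circle_inner w p q = integral {\<alpha>..2 * pi - \<alpha>} ?F"
    unfolding circle_inner_def by blast+
qed

lemma circle_inner_weight_sin:
  assumes "0 \<le> \<alpha>"
  shows "(\<lambda>\<theta>. poly p (cis \<theta>) * cnj (poly q (cis \<theta>)) * of_real (weight_sin \<alpha> \<theta>)) integrable_on {0..2 * pi}"
    and "circle_inner (weight_sin \<alpha>) p q = integral {\<alpha>..2 * pi - \<alpha>}
      (\<lambda>\<theta>. poly p (cis \<theta>) * cnj (poly q (cis \<theta>)) * of_real (sin (\<theta> / 2)))"
proof -
  have "continuous_on {\<alpha>..2 * pi - \<alpha>} (\<lambda>\<theta>. sin (\<theta> / 2))"
    by (intro continuous_intros) auto
  then have *: "continuous_on {\<alpha>..2 * pi - \<alpha>} (weight_sin \<alpha>)"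
    by (rule continuous_on_eq) (auto simp: weight_sin_def)
  have 0: "weight_sin \<alpha> \<theta> = 0" if "\<theta> \<notin> {\<alpha>..2 * pi - \<alpha>}" for \<theta>
    using that by (auto simp: weight_sin_def)
  show "(\<lambda>\<theta>. poly p (cis \<theta>) * cnj (poly q (cis \<theta>)) * of_real (weight_sin \<alpha> \<theta>)) integrable_on {0..2 * pi}"
    by (rule circle_inner_arc_weight(1)[OF assms * 0])
  have "circle_inner (weight_sin \<alpha>) p q = integral {\<alpha>..2 * pi - \<alpha>}
      (\<lambda>\<theta>. poly p (cis \<theta>) * cnj (poly q (cis \<theta>)) * of_real (weight_sin \<alpha> \<theta>))"
    by (rule circle_inner_arc_weight(2)[OF assms * 0])
  also have "\<dots> = integral {\<alpha>..2 * pi - \<alpha>}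
      (\<lambda>\<theta>. poly p (cis \<theta>) * cnj (poly q (cis \<theta>)) * of_real (sin (\<theta> / 2)))"
    by (rule integral_cong) (simp add: weight_sin_def)
  finally show "circle_inner (weight_sin \<alpha>) p q = integral {\<alpha>..2 * pi - \<alpha>}
      (\<lambda>\<theta>. poly p (cis \<theta>) * cnj (poly q (cis \<theta>)) * of_real (sin (\<theta> / 2)))" .
qed

lemma circle_inner_weight_inv_sin:
  assumes "0 < \<alpha>"
  shows "(\<lambda>\<theta>. poly p (cis \<theta>) * cnj (poly q (cis \<theta>)) * of_real (weight_inv_sin \<alpha> \<theta>)) integrable_on {0..2 * pi}"
    and "circle_inner (weight_inv_sin \<alpha>) p q = integral {\<alpha>..2 * pi - \<alpha>}
      (\<lambda>\<theta>. poly p (cis \<theta>) * cnj (poly q (cis \<theta>)) * of_real (weight_inv_sin \<alpha> \<theta>))"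
proof -
  have "continuous_on {\<alpha>..2 * pi - \<alpha>} (\<lambda>\<theta>. 1 / sin (\<theta> / 2))"
    using sin_half_pos[OF assms] by (intro continuous_intros) fastforce+
  then have *: "continuous_on {\<alpha>..2 * pi - \<alpha>} (weight_inv_sin \<alpha>)"
    by (rule continuous_on_eq) (auto simp: weight_inv_sin_def)
  have 0: "weight_inv_sin \<alpha> \<theta> = 0" if "\<theta> \<notin> {\<alpha>..2 * pi - \<alpha>}" for \<theta>
    using that by (auto simp: weight_inv_sin_def)
  note arc = circle_inner_arc_weight[OF less_imp_le[OF assms] * 0]
  show "(\<lambda>\<theta>. poly p (cis \<theta>) * cnj (poly q (cis \<theta>)) * of_real (weight_inv_sin \<alpha> \<theta>)) integrable_on {0..2 * pi}"
    by (rule arc(1))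
  show "circle_inner (weight_inv_sin \<alpha>) p q = integral {\<alpha>..2 * pi - \<alpha>}
      (\<lambda>\<theta>. poly p (cis \<theta>) * cnj (poly q (cis \<theta>)) * of_real (weight_inv_sin \<alpha> \<theta>))"
    by (rule arc(2))
qed

lemma opuc_weight_sin:
  assumes \<alpha>: "0 \<le> \<alpha>" "\<alpha> < pi" and monic: "monic_opuc (weight_sin \<alpha>) \<Phi> chi"
  defines "g \<equiv> gam \<alpha>" and "L \<equiv> monic_legendre"
  shows "cis \<theta> \<noteq> 1 \<Longrightarrow> poly (\<Phi> n) (cis \<theta>) =
      of_real (2 * g) ^ (n + 1) * zhalf (int n) \<theta> / (cis \<theta> - 1) *
      (zhalf 1 \<theta> * of_real (L (n + 1) (arc_x \<alpha> \<theta>)) -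
       of_real (L (n + 1) (1 / g) / L n (1 / g)) * of_real (L n (arc_x \<alpha> \<theta>)))" (is "_ \<Longrightarrow> ?formula")
    and "1 / (chi n)\<^sup>2 =
      (2 * g) ^ (2 * n) * (g\<^sup>2 / pi) * (L (n + 1) (1 / g) / L n (1 / g)) * legendre_h n" (is ?norm)
proof -
  interpret opuc "weight_sin \<alpha>" \<Phi> chi
    using monic circle_inner_weight_sin(1) \<alpha> by unfold_locales
  have g: "g > 0"
    using gam_pos \<alpha> unfolding g_def by blast
  define \<rho> where "\<rho> = L (n + 1) (1 / g) / L n (1 / g)"
  \<comment> \<open>The multiple of A_n is chosen to cancel A_(n+1) at z = 1. The factor 2 gamma
    makes up for A_n carrying one power of 2 gamma less.\<close>
  define D where "D = arc_legendre \<alpha> (Suc n) - smult (of_real (2 * g * \<rho>)) (arc_legendre \<alpha> n)"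
  have D: "poly D (cis \<theta>) = of_real (2 * g) ^ (n + 1) * zhalf (int n) \<theta> *
      (zhalf 1 \<theta> * of_real (L (n + 1) (arc_x \<alpha> \<theta>)) - of_real \<rho> * of_real (L n (arc_x \<alpha> \<theta>)))" for \<theta>
    using g zhalf_add[of 1 "int n" \<theta>]
    by (simp add: D_def poly_arc_legendre g_def L_def algebra_simps)
  have "L n (1 / g) > 0"
    using g unfolding L_def g_def by (intro monic_legendre_pos) (simp add: gam_def)
  \<comment> \<open>The formula for \<open>D\<close> holds for every theta, also off the arc; theta
    = 0 gives z = 1 and x = 1/gamma.\<close>
  then have "poly D 1 = 0"
    using D[of 0] g by (simp add: \<rho>_def arc_x_def g_def[symmetric] zhalf_eq_cis)
  then have "[:- 1, 1:] dvd D"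
    by (simp add: poly_eq_0_iff_dvd)
  then obtain P where P: "D = [:- 1, 1:] * P"
    by (elim dvdE)
  have "coeff D (Suc n) = 1" "degree D \<le> Suc n"
    using arc_legendre_monic[of \<alpha>] unfolding D_def
    by (auto simp: coeff_eq_0 intro!: degree_diff_le order_trans[OF degree_smult_le])
  then have "degree D = Suc n" "lead_coeff D = 1"
    using le_degree[of D "Suc n"] by auto
  moreover from this have "P \<noteq> 0"
    by (auto simp: P)
  ultimately have "degree P = n" "lead_coeff P = 1"
    using degree_mult_eq[of "[:- 1, 1:]" P] lead_coeff_mult[of "[:- 1, 1:]" P] by (auto simp: P)
  have PD: "poly P (cis \<theta>) * (cis \<theta> - 1) = poly D (cis \<theta>)" for \<theta>
    by (simp add: P algebra_simps)
  have inner: "circle_inner (weight_sin \<alpha>) P (monom 1 j) =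
      (if j = n then of_real ((2 * g) ^ (2 * n + 2) * \<rho> * legendre_h n / 2) else 0)" if "j \<le> n" for j
  proof -
    let ?M = "\<lambda>k m \<theta>. zhalf k \<theta> * complex_of_real (monic_legendre m (arc_x \<alpha> \<theta>))"
    let ?k = "int n - 2 * int j"
    \<comment> \<open>Since P = D / (z - 1), the weight cancels the sine in z - 1 and leaves
      z^(-1/2) / (2i).\<close>
    have integrand: "poly P (cis \<theta>) * cnj (poly (monom 1 j) (cis \<theta>)) * of_real (sin (\<theta> / 2)) =
        of_real (2 * g) ^ (n + 1) / (2 * \<i>) * (?M ?k (n + 1) \<theta> - of_real \<rho> * ?M (?k - 1) n \<theta>)" for \<theta>
    proof -
      have z: "zhalf 1 \<theta> * zhalf (- 1) \<theta> = 1"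
        using zhalf_add[of 1 "- 1" \<theta>] by simp
      have P: "poly P (cis \<theta>) * of_real (sin (\<theta> / 2)) = poly D (cis \<theta>) * zhalf (- 1) \<theta> / (2 * \<i>)"
        using z unfolding PD[symmetric] cis_minus_1 by (simp add: field_simps)
      have q: "cnj (poly (monom 1 j) (cis \<theta>)) = zhalf (- 2 * int j) \<theta>"
        by (simp add: poly_monom cis_power_eq_zhalf cnj_zhalf)
      have k: "zhalf ?k \<theta> = zhalf (int n) \<theta> * zhalf (- 2 * int j) \<theta>"
        "zhalf (?k - 1) \<theta> = zhalf (int n) \<theta> * zhalf (- 2 * int j) \<theta> * zhalf (- 1) \<theta>"
        by (simp_all flip: zhalf_add)
      have expand: "c * A * (Z * l1 - r * l0) * Y / (2 * \<i>) * B =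
          c / (2 * \<i>) * (A * B * l1 - r * (A * B * Y * l0))" if "Z * Y = 1" for c A B Z Y l0 l1 r :: complex
      proof -
        have "c * A * (Z * l1 - r * l0) * Y / (2 * \<i>) * B =
            c / (2 * \<i>) * (A * B * (Z * Y * l1) - r * (A * B * Y * l0))"
          by (simp add: field_simps)
        then show ?thesis
          by (simp add: that)
      qed
      have "poly P (cis \<theta>) * cnj (poly (monom 1 j) (cis \<theta>)) * of_real (sin (\<theta> / 2)) =
          (poly P (cis \<theta>) * of_real (sin (\<theta> / 2))) * cnj (poly (monom 1 j) (cis \<theta>))"
        by (rule semiring_normalization_rules(16))
      also have "\<dots> = poly D (cis \<theta>) * zhalf (- 1) \<theta> / (2 * \<i>) * zhalf (- 2 * int j) \<theta>"
        by (simp only: P q)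
      finally show ?thesis
        by (simp only: D L_def k expand[OF z])
    qed

    have "(\<lambda>\<theta>. ?M ?k (n + 1) \<theta>) integrable_on {\<alpha>..2 * pi - \<alpha>}"
      "(\<lambda>\<theta>. of_real \<rho> * ?M (?k - 1) n \<theta>) integrable_on {\<alpha>..2 * pi - \<alpha>}"
      by (intro integrable_continuous_interval continuous_intros)+
    note Henstock_Kurzweil_Integration.integral_diff[OF this]
    then have "circle_inner (weight_sin \<alpha>) P (monom 1 j) =
        of_real (2 * g) ^ (n + 1) / (2 * \<i>) * (arc_moment \<alpha> ?k (n + 1) - of_real \<rho> * arc_moment \<alpha> (?k - 1) n)"
      unfolding circle_inner_weight_sin(2)[OF \<alpha>(1)] integrand arc_moment_def
      by (simp only: integral_mult_right)
    \<comment> \<open>Here |n - 2j| is at most n, short of the n + 2 at which L_(n+1) has its first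
      nonzero moment.\<close>
    moreover have "arc_moment \<alpha> ?k (n + 1) = 0"
      using \<alpha> that unfolding arc_moment_def by (subst integral_zhalf_legendre) auto
    \<comment> \<open>The index n - 2j - 1 reaches absolute value n + 1 only for j = n, where it is
      negative; hence the sign.\<close>
    moreover have "arc_moment \<alpha> (?k - 1) n = (if j = n then - \<i> * of_real ((2 * g) ^ Suc n * legendre_h n) else 0)"
      using \<alpha> that unfolding arc_moment_def g_def by (subst integral_zhalf_legendre) auto
    moreover have "(2 * g) ^ (2 * n + 2) = (2 * g) ^ Suc n * (2 * g) ^ Suc n"
      unfolding power_add[symmetric] by (rule arg_cong[where f = "\<lambda>k. (2 * g) ^ k"]) simp
    moreover have "of_real x / (2 * \<i>) * (0 - of_real \<rho> * (- \<i> * of_real (x * h))) =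
        complex_of_real (x * x * \<rho> * h / 2)" for x h
      by (simp add: complex_eq_iff)
    ultimately show ?thesis
      by (cases "j = n") (simp_all only: Suc_eq_plus1 of_real_power[symmetric] mult_zero_right diff_self simp_thms if_True if_False)
  qed
  have "\<Phi> n = P" and norm: "circle_inner (weight_sin \<alpha>) P (monom 1 n) = 2 * pi / (chi n)\<^sup>2"
    using opuc_unique[of P n] \<open>degree P = n\<close> \<open>lead_coeff P = 1\<close> inner by auto
  then show "cis \<theta> \<noteq> 1 \<Longrightarrow> ?formula"
    using PD[of \<theta>] D[of \<theta>] by (simp add: \<rho>_def field_simps)
  have "2 * pi / (chi n)\<^sup>2 = (2 * g) ^ (2 * n + 2) * \<rho> * legendre_h n / 2"
    using norm inner[of n] unfolding of_real_eq_iff[symmetric, where 'a = complex] by simp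
  moreover have "1 / (chi n)\<^sup>2 = 2 * pi / (chi n)\<^sup>2 / (2 * pi)"
    by simp
  ultimately have "1 / (chi n)\<^sup>2 = (2 * g) ^ (2 * n + 2) * \<rho> * legendre_h n / 2 / (2 * pi)"
    by simp
  \<comment> \<open>Two of the factors 2 gamma combine with 1/(4 pi) to gamma^2/pi.\<close>
  also have "\<dots> = (2 * g) ^ (2 * n) * (g\<^sup>2 / pi) * \<rho> * legendre_h n"
    by (simp add: power_add power2_eq_square)
  finally show ?norm
    by (simp add: \<rho>_def)
qed

lemma opuc_weight_inv_sin:
  assumes \<alpha>: "0 < \<alpha>" "\<alpha> < pi" and monic: "monic_opuc (weight_inv_sin \<alpha>) \<Phi> chi"
  defines "g \<equiv> gam \<alpha>" and "L \<equiv> monic_legendre" and "t \<equiv> tcoef \<alpha>"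
  shows "complex_of_real (1 / (chi 0)\<^sup>2) = t 0"
    and "poly (\<Phi> (Suc n)) (cis \<theta>) = of_real (2 * g) ^ Suc n * zhalf (int (Suc n)) \<theta> *
      (of_real (L (Suc n) (arc_x \<alpha> \<theta>)) -
       zhalf (- 1) \<theta> * (t (Suc n) / t n) * of_real (L n (arc_x \<alpha> \<theta>)))" (is ?formula)
    and "complex_of_real (1 / (chi (Suc n))\<^sup>2) =
      of_real (2 * g) ^ (2 * Suc n) * (t (Suc n) / (of_real pi * t n)) * of_real (legendre_h n)" (is ?norm)
proof -
  interpret opuc "weight_inv_sin \<alpha>" \<Phi> chi
    using monic circle_inner_weight_inv_sin(1) \<alpha> by unfold_locales
  have g: "g > 0"
    using gam_pos \<alpha> unfolding g_def by simp
  let ?A = "arc_legendre \<alpha>" and ?G = "complex_of_real (2 * g)"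
  let ?ip = "circle_inner (weight_inv_sin \<alpha>)"
  have monom: "cnj (poly (monom 1 j) (cis \<theta>)) = zhalf (- 2 * int j) \<theta>" for j \<theta>
    by (simp add: poly_monom cis_power_eq_zhalf cnj_zhalf)
  have A0: "?ip (?A m) (monom 1 0) = 2 * pi * ?G ^ m * t m" for m
  proof -
    have "?ip (?A m) (monom 1 0) = integral {\<alpha>..2 * pi - \<alpha>} (\<lambda>\<theta>. ?G ^ m *
       (zhalf (int m) \<theta> * of_real (monic_legendre m (arc_x \<alpha> \<theta>)) * of_real (weight_inv_sin \<alpha> \<theta>)))"
      using \<alpha> g by (simp add: circle_inner_weight_inv_sin poly_arc_legendre g_def monom poly_monom mult_ac)
    then show ?thesis
      by (simp add: t_def tcoef_def)
  qed
  \<comment> \<open>The conjugate of z^j - z^(j+1) on the circle is z^(-j-1) (z - 1), and the sine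
    in z - 1 cancels the weight.\<close>
  have diff: "?ip (?A m) (monom 1 j - monom 1 (Suc j)) = ?G ^ m * 2 * \<i> * arc_moment \<alpha> (int m - 2 * int j - 1) m" for m j
  proof -
    have "poly (?A m) (cis \<theta>) * cnj (poly (monom 1 j - monom 1 (Suc j)) (cis \<theta>)) * of_real (weight_inv_sin \<alpha> \<theta>) =
       (?G ^ m * 2 * \<i>) * (zhalf (int m - 2 * int j - 1) \<theta> * of_real (monic_legendre m (arc_x \<alpha> \<theta>)))"
      if "\<theta> \<in> {\<alpha>..2 * pi - \<alpha>}" for \<theta>
    proof -
      have "cnj (poly (monom 1 j - monom 1 (Suc j)) (cis \<theta>)) = zhalf (- 2 * int (Suc j)) \<theta> * (zhalf 2 \<theta> - 1)"
        by (simp add: monom[simplified] right_diff_distrib flip: zhalf_add)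
      also have "zhalf 2 \<theta> - 1 = 2 * \<i> * of_real (sin (\<theta> / 2)) * zhalf 1 \<theta>"
        using cis_minus_1[of \<theta>] by (simp add: zhalf_eq_cis)
      finally have "cnj (poly (monom 1 j - monom 1 (Suc j)) (cis \<theta>)) * of_real (weight_inv_sin \<alpha> \<theta>) =
          2 * \<i> * (zhalf (- 2 * int (Suc j)) \<theta> * zhalf 1 \<theta>)"
        using sin_half_pos[OF \<alpha>(1) that] that by (simp add: weight_inv_sin_def)
      moreover have "zhalf (int m - 2 * int j - 1) \<theta> =
          zhalf (int m) \<theta> * (zhalf (- 2 * int (Suc j)) \<theta> * zhalf 1 \<theta>)"
        by (simp add: algebra_simps flip: zhalf_add)
      ultimately show ?thesis
        using g by (simp add: poly_arc_legendre g_def mult_ac)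
    qed
    then have "?ip (?A m) (monom 1 j - monom 1 (Suc j)) = integral {\<alpha>..2 * pi - \<alpha>} (\<lambda>\<theta>.
       (?G ^ m * 2 * \<i>) * (zhalf (int m - 2 * int j - 1) \<theta> * of_real (monic_legendre m (arc_x \<alpha> \<theta>))))"
      unfolding circle_inner_weight_inv_sin(2)[OF \<alpha>(1)] by (rule integral_cong)
    then show ?thesis
      by (simp add: arc_moment_def)
  qed
  \<comment> \<open>The moment index m - 2j - 1 hits the threshold -(m + 1) exactly at j = m, so the
    inner products stay constant up to z^m and first change at z^(m+1).\<close>
  have step: "?ip (?A m) (monom 1 (Suc j)) = ?ip (?A m) (monom 1 j) -
      (if j = m then 2 * ?G ^ (2 * m + 1) * legendre_h m else 0)" if "j \<le> m" for m j
  proof -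
    have "arc_moment \<alpha> (int m - 2 * int j - 1) m =
        (if j = m then - \<i> * of_real ((2 * g) ^ Suc m * legendre_h m) else 0)"
      using \<alpha> that unfolding arc_moment_def g_def by (subst integral_zhalf_legendre) auto
    moreover have "a * 2 * \<i> * (- \<i> * (b * h)) = 2 * (a * b) * h" for a b h
      by (simp add: complex_eq_iff algebra_simps)
    moreover have "?G ^ (2 * m + 1) = ?G ^ m * ?G ^ Suc m"
      unfolding power_add[symmetric] by (rule arg_cong[where f = "\<lambda>k. ?G ^ k"]) simp
    ultimately have "?ip (?A m) (monom 1 j - monom 1 (Suc j)) =
        (if j = m then 2 * ?G ^ (2 * m + 1) * legendre_h m else 0)"
      unfolding diff by (simp only: of_real_mult of_real_power mult_zero_right split: if_split) simp
    then show ?thesis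
      using inner_add_smult_right[of "?A m" "monom 1 j" "- 1" "monom 1 (Suc j)"]
      by (simp add: diff_eq_eq eq_diff_eq add.commute)
  qed
  have A: "?ip (?A m) (monom 1 j) = 2 * pi * ?G ^ m * t m" if "j \<le> m" for m j
    using that
  proof (induction j)
    case 0
    show ?case
      by (rule A0)
  next
    case (Suc j)
    then show ?case
      using step[of j m] by simp
  qed
  \<comment> \<open>If \<open>t m\<close> vanished, \<open>?A m\<close> would be orthogonal to every polynomial of degree at most \<open>m\<close>.\<close>
  have t: "t m \<noteq> 0" for m
  proof
    assume "t m = 0"
    then have "?A m = 0"
      using arc_legendre_monic(1)[of \<alpha> m] A[of _ m]
      by (intro inner_nondegenerate[of "Suc m"]) (auto simp: coeff_eq_0)
    then show False
      using arc_legendre_monic(2)[of \<alpha> m] by simp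
  qed
  \<comment> \<open>The division by 2 pi takes place in the complex numbers, where \<open>t\<close>
    has its values.\<close>
  have recip: "complex_of_real (1 / (chi k)\<^sup>2) = c" if "complex_of_real (2 * pi / (chi k)\<^sup>2) = of_real (2 * pi) * c" for k c
  proof -
    have "complex_of_real (1 / (chi k)\<^sup>2) = of_real (2 * pi / (chi k)\<^sup>2) / of_real (2 * pi)"
      by simp
    then show ?thesis
      unfolding that by simp
  qed
  have "2 * pi / (chi 0)\<^sup>2 = 2 * pi * t 0"
    using opuc_unique(2)[of "?A 0" 0] arc_legendre_monic[of \<alpha> 0] A[of 0 0] by simp
  then show "complex_of_real (1 / (chi 0)\<^sup>2) = t 0"
    by (rule recip)

  \<comment> \<open>Against each of 1, ..., z^n the inner products of A_(n+1) and A_n are 2 pi (2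
    gamma)^(n+1) t_(n+1) and 2 pi (2 gamma)^n t_n; their ratio is the coefficient that cancels
    them.\<close>
  define P where "P = ?A (Suc n) - smult (?G * (t (Suc n) / t n)) (?A n)"
  have c: "coeff P (Suc n) = 1" and "degree P \<le> Suc n"
    using arc_legendre_monic[of \<alpha>] unfolding P_def
    by (auto simp: coeff_eq_0 intro!: degree_diff_le order_trans[OF degree_smult_le])
  then have "degree P = Suc n"
    using le_degree[of P "Suc n"] by auto
  moreover have low: "?ip P (monom 1 j) = 0" if "j \<le> n" for j
    using that t[of n] by (simp add: P_def inner_diff_smult_left A)
  \<comment> \<open>Against z^(n+1) the constant parts cancel as before; what is left is the change
    in the inner product of A_n from z^n to z^(n+1).\<close>
  moreover have top: "?ip P (monom 1 (Suc n)) = 2 * ?G ^ (2 * n + 2) * (t (Suc n) / t n) * legendre_h n"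
  proof -
    have "?ip P (monom 1 (Suc n)) = 2 * pi * ?G ^ Suc n * t (Suc n) -
        ?G * (t (Suc n) / t n) * (2 * pi * ?G ^ n * t n - 2 * ?G ^ (2 * n + 1) * legendre_h n)"
      using step[of n n] by (simp only: P_def inner_diff_smult_left A order_refl if_True simp_thms)
    then show ?thesis
      using t[of n] by (simp add: field_simps)
  qed
  ultimately have P: "\<Phi> (Suc n) = P" "?ip P (monom 1 (Suc n)) = 2 * pi / (chi (Suc n))\<^sup>2"
    using opuc_unique[of P "Suc n"] c by auto
  have "zhalf (int (Suc n)) \<theta> * zhalf (- 1) \<theta> = zhalf (int n) \<theta>"
    by (simp flip: zhalf_add)
  then show ?formula
    using g by (simp add: P P_def poly_arc_legendre g_def L_def algebra_simps)
  show ?norm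
  proof (rule recip)
    have "?G ^ (2 * n + 2) = ?G ^ (2 * Suc n)"
      by simp
    then show "complex_of_real (2 * pi / (chi (Suc n))\<^sup>2) =
        of_real (2 * pi) * (?G ^ (2 * Suc n) * (t (Suc n) / (of_real pi * t n)) * of_real (legendre_h n))"
      unfolding P(2)[symmetric] top by (simp only:) (simp add: field_simps)
  qed
qed

theorem lemma2p2:
  fixes \<alpha> :: real and \<Phi> :: "nat \<Rightarrow> complex poly" and chi :: "nat \<Rightarrow> real"
  shows
    "(0 \<le> \<alpha> \<and> \<alpha> < pi \<and> monic_opuc (weight_sin \<alpha>) \<Phi> chi \<longrightarrow>
        (\<forall>n. (\<forall>\<theta>\<in>{0..2 * pi}. cis \<theta> \<noteq> 1 \<longrightarrow>
                poly (\<Phi> n) (cis \<theta>) =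
                  of_real (2 * gam \<alpha>) ^ (n + 1) * zhalf (int n) \<theta> / (cis \<theta> - 1) *
                  (zhalf 1 \<theta> * of_real (monic_legendre (n + 1) (arc_x \<alpha> \<theta>)) -
                   of_real (monic_legendre (n + 1) (1 / gam \<alpha>) / monic_legendre n (1 / gam \<alpha>)) *
                     of_real (monic_legendre n (arc_x \<alpha> \<theta>)))) \<and>
             1 / (chi n)\<^sup>2 =
               (2 * gam \<alpha>) ^ (2 * n) * ((gam \<alpha>)\<^sup>2 / pi) *
               (monic_legendre (n + 1) (1 / gam \<alpha>) / monic_legendre n (1 / gam \<alpha>)) *
               legendre_h n)) \<and>
     (0 < \<alpha> \<and> \<alpha> < pi \<and> monic_opuc (weight_inv_sin \<alpha>) \<Phi> chi \<longrightarrow>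
        complex_of_real (1 / (chi 0)\<^sup>2) = tcoef \<alpha> 0 \<and>
        (\<forall>n\<ge>1. (\<forall>\<theta>\<in>{0..2 * pi}.
                poly (\<Phi> n) (cis \<theta>) =
                  of_real (2 * gam \<alpha>) ^ n * zhalf (int n) \<theta> *
                  (of_real (monic_legendre n (arc_x \<alpha> \<theta>)) -
                   zhalf (- 1) \<theta> * (tcoef \<alpha> n / tcoef \<alpha> (n - 1)) *
                     of_real (monic_legendre (n - 1) (arc_x \<alpha> \<theta>)))) \<and>
             complex_of_real (1 / (chi n)\<^sup>2) =
               of_real (2 * gam \<alpha>) ^ (2 * n) * (tcoef \<alpha> n / (of_real pi * tcoef \<alpha> (n - 1))) *
               of_real (legendre_h (n - 1))))"
  (is "?sin \<and> ?inv_sin")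
proof
  show ?sin
    using opuc_weight_sin by blast
  show ?inv_sin
  proof (intro impI conjI allI)
    assume "0 < \<alpha> \<and> \<alpha> < pi \<and> monic_opuc (weight_inv_sin \<alpha>) \<Phi> chi"
    then have \<alpha>: "0 < \<alpha>" "\<alpha> < pi" "monic_opuc (weight_inv_sin \<alpha>) \<Phi> chi"
      by auto
    show "complex_of_real (1 / (chi 0)\<^sup>2) = tcoef \<alpha> 0"
      by (rule opuc_weight_inv_sin(1)[OF \<alpha>])
    fix n :: nat assume "1 \<le> n"
    then obtain m where n: "n = Suc m"
      by (cases n) auto
    show "\<forall>\<theta>\<in>{0..2 * pi}. poly (\<Phi> n) (cis \<theta>) =
        of_real (2 * gam \<alpha>) ^ n * zhalf (int n) \<theta> *
        (of_real (monic_legendre n (arc_x \<alpha> \<theta>)) -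
         zhalf (- 1) \<theta> * (tcoef \<alpha> n / tcoef \<alpha> (n - 1)) * of_real (monic_legendre (n - 1) (arc_x \<alpha> \<theta>)))"
      unfolding n diff_Suc_1 using opuc_weight_inv_sin(2)[OF \<alpha>] by blast
    show "complex_of_real (1 / (chi n)\<^sup>2) =
        of_real (2 * gam \<alpha>) ^ (2 * n) * (tcoef \<alpha> n / (of_real pi * tcoef \<alpha> (n - 1))) *
        of_real (legendre_h (n - 1))"
      unfolding n diff_Suc_1 by (rule opuc_weight_inv_sin(3)[OF \<alpha>])
  qed
qed

end
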